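(* Let $(X,\Phi)$ be an NAIFS of surjective continuous maps on a (non-empty) compact metric space $(X,d)$ without any isolated point. If $(X,\Phi)$ satisfies the specification property, then it has positive topological entropy, i.e. $h_{\mathrm{top}}(X,\Phi)>0$.
   Context: NAIFS: A non-autonomous iterated function system (NAIFS) of continuous maps on a compact space $X$ is a pair $(X,\Phi)$ where $\Phi=\{\Phi^{(j)}\}_{j\ge 1}$, $\Phi^{(j)}=\{\varphi_i^{(j)}:X\to X\}_{i\in I^{(j)}}$ is a collection of continuous maps and $I^{(j)}$ is a non-empty finite index set. It is of surjective maps if every $\varphi_i^{(j)}$ is surjective. For $m,n\ge1$ put $I^{m,n}:=\prod_{j=0}^{n-1}I^{(m+j)}$ and $I^{m,\infty}:=\prod_{j=m}^\infty I^{(j)}$ (finite and infinite words $w=w_mw_{m+1}\cdots$). For such a word and $k\ge 1$ (at most the length of $w$) put $\varphi_w^{m,k}:=\varphi_{w_{m+k-1}}^{(m+k-1)}\circ\cdots\circ\varphi_{w_m}^{(m)}$, $\varphi_w^{m,0}:=\mathrm{id}_X$, and $\varphi_w^{m,-k}(A):=(\varphi_w^{m,k})^{-1}(A)$ for sets $A$. Entropy: For an open cover $\mathcal A$ of $X$ and $w\in I^{1,n}$ let $\mathcal A_w^{1,n}:=\bigvee_{j=0}^{n}\varphi_w^{1,-j}(\mathcal A)$, where $\varphi_w^{1,-j}(\mathcal A)=\{\varphi_w^{1,-j}(A):A\in\mathcal A\}$ and $\bigvee_i\mathcal A_i$ is the family of all intersections $\bigcap_i A_i$ with $A_i\in\mathcal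 A_i$; $\mathcal N(\cdot)$ denotes the minimal cardinality of a subcover. Put $$h_{\mathrm{top}}(X,\Phi):=\sup_{\mathcal A}\limsup_{n\to\infty}\frac1n\log\Big(\frac1{\#(I^{1,n})}\sum_{w\in I^{1,n}}\mathcal N(\mathcal A_w^{1,n})\Big),$$ the supremum being over all open covers $\mathcal A$ of $X$ (values in $[0,\infty]$). Specification property: for every $\delta>0$ there is $N(\delta)\in\mathbb N$ such that for each $w\in I^{1,\infty}$, any $x_1,\dots,x_s\in X$ with $s\ge2$ and any integers $0=j_1\le k_1<j_2\le k_2<\cdots<j_s\le k_s$ with $j_{n+1}-k_n\ge N(\delta)$ for $n=1,\dots,s-1$, there is $x\in X$ with $d(\varphi_w^{1,i}(x),\varphi_w^{1,i}(x_m))\le\delta$ for each $1\le m\le s$ and all $j_m\le i\le k_m$. *)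

theory Defs
  imports "HOL-Analysis.Analysis"
begin

text \<open>
  A non-autonomous iterated function system on a subset \<open>X\<close> of an ambient space is given by index
  sets \<open>I j\<close> and maps \<open>\<phi> j i\<close> for \<open>j \<ge> 1\<close> and \<open>i \<in> I j\<close>; the values \<open>I 0\<close>, \<open>\<phi> 0\<close> and the behaviour
  of the maps outside \<open>X\<close> play no role. Topological notions on \<open>X\<close> are those of the
  subspace topology.
\<close>

definition naifs :: "'a::topological_space set \<Rightarrow> (nat \<Rightarrow> 'i set) \<Rightarrow> (nat \<Rightarrow> 'i \<Rightarrow> 'a \<Rightarrow> 'a) \<Rightarrow> bool"
  where "naifs X I \<phi> \<longleftrightarrow>
    compact X \<and>
    (\<forall>j\<ge>1. finite (I j) \<and> I j \<noteq> {} \<and>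
      (\<forall>i\<in>I j. \<phi> j i \<in> X \<rightarrow> X \<and> continuous_on X (\<phi> j i)))"

definition surjective_maps :: "'a set \<Rightarrow> (nat \<Rightarrow> 'i set) \<Rightarrow> (nat \<Rightarrow> 'i \<Rightarrow> 'a \<Rightarrow> 'a) \<Rightarrow> bool"
  where "surjective_maps X I \<phi> \<longleftrightarrow> (\<forall>j\<ge>1. \<forall>i\<in>I j. \<phi> j i ` X = X)"

text \<open>
  Words keep their absolute positions: the letter of \<open>w\<close> taken from \<open>I j\<close> is \<open>w j\<close>, so a word
  starting at position \<open>m\<close> reads \<open>w m, w (m + 1), \<dots>\<close>.
\<close>

definition words :: "(nat \<Rightarrow> 'i set) \<Rightarrow> nat \<Rightarrow> nat \<Rightarrow> (nat \<Rightarrow> 'i) set"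
  where "words I m n = (\<Pi>\<^sub>E j\<in>{m..<m + n}. I j)"

definition infinite_words :: "(nat \<Rightarrow> 'i set) \<Rightarrow> nat \<Rightarrow> (nat \<Rightarrow> 'i) set"
  where "infinite_words I m = (\<Pi>\<^sub>E j\<in>{m..}. I j)"

primrec word_map :: "(nat \<Rightarrow> 'i \<Rightarrow> 'a \<Rightarrow> 'a) \<Rightarrow> (nat \<Rightarrow> 'i) \<Rightarrow> nat \<Rightarrow> nat \<Rightarrow> 'a \<Rightarrow> 'a"
  where
    "word_map \<phi> w m 0 = id"
  | "word_map \<phi> w m (Suc k) = \<phi> (m + k) (w (m + k)) \<circ> word_map \<phi> w m k"

definition open_cover :: "'a::topological_space set \<Rightarrow> 'a set set \<Rightarrow> bool"
  where "open_cover X \<A> \<longleftrightarrow> (\<forall>A\<in>\<A>. openin (top_of_set X) A) \<and> \<Union>\<A> = X"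

definition preimage_family :: "'a set \<Rightarrow> ('a \<Rightarrow> 'a) \<Rightarrow> 'a set set \<Rightarrow> 'a set set"
  where "preimage_family X f \<A> = (\<lambda>A. f -` A \<inter> X) ` \<A>"

definition join_families :: "'j set \<Rightarrow> ('j \<Rightarrow> 'a set set) \<Rightarrow> 'a set set"
  where "join_families J \<C> = {(\<Inter>j\<in>J. F j) | F. \<forall>j\<in>J. F j \<in> \<C> j}"

definition word_cover ::
    "'a set \<Rightarrow> (nat \<Rightarrow> 'i \<Rightarrow> 'a \<Rightarrow> 'a) \<Rightarrow> 'a set set \<Rightarrow> (nat \<Rightarrow> 'i) \<Rightarrow> nat \<Rightarrow> nat \<Rightarrow> 'a set set"
  where "word_cover X \<phi> \<A> w m n =
    join_families {0..n} (\<lambda>j. preimage_family X (word_map \<phi> w m j) \<A>)"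

text \<open>Finiteness is demanded because \<open>card\<close> is \<open>0\<close> on infinite families.\<close>

definition min_subcover :: "'a set \<Rightarrow> 'a set set \<Rightarrow> nat"
  where "min_subcover X \<C> = (LEAST k. \<exists>\<B>\<subseteq>\<C>. finite \<B> \<and> X \<subseteq> \<Union>\<B> \<and> card \<B> = k)"

definition h_top :: "'a::topological_space set \<Rightarrow> (nat \<Rightarrow> 'i set) \<Rightarrow> (nat \<Rightarrow> 'i \<Rightarrow> 'a \<Rightarrow> 'a) \<Rightarrow> ereal"
  where "h_top X I \<phi> =
    (SUP \<A>\<in>{\<A>. open_cover X \<A>}.
      limsup (\<lambda>n. ereal (1 / real n *
        ln (1 / real (card (words I 1 n)) *
            (\<Sum>w\<in>words I 1 n. real (min_subcover X (word_cover X \<phi> \<A> w 1 n)))))))"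

text \<open>
  The points and times are indexed by \<open>1, \<dots>, s\<close>; the gap condition \<open>j (n + 1) - k n \<ge> N\<close> is written
  additively to avoid truncated subtraction.
\<close>

definition specification_property ::
    "'a::metric_space set \<Rightarrow> (nat \<Rightarrow> 'i set) \<Rightarrow> (nat \<Rightarrow> 'i \<Rightarrow> 'a \<Rightarrow> 'a) \<Rightarrow> bool"
  where "specification_property X I \<phi> \<longleftrightarrow>
    (\<forall>\<delta>>0. \<exists>N::nat. \<forall>w\<in>infinite_words I 1.
      \<forall>(s::nat) (x :: nat \<Rightarrow> 'a) (j :: nat \<Rightarrow> nat) (k :: nat \<Rightarrow> nat).
        s \<ge> 2 \<longrightarrow>
        (\<forall>m\<in>{1..s}. x m \<in> X) \<longrightarrow>
        j 1 = 0 \<longrightarrow>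
        (\<forall>n\<in>{1..s}. j n \<le> k n) \<longrightarrow>
        (\<forall>n\<in>{1..<s}. k n < j (n + 1)) \<longrightarrow>
        (\<forall>n\<in>{1..<s}. k n + N \<le> j (n + 1)) \<longrightarrow>
        (\<exists>y\<in>X. \<forall>m\<in>{1..s}. \<forall>i\<in>{j m..k m}.
          dist (word_map \<phi> w 1 i y) (word_map \<phi> w 1 i (x m)) \<le> \<delta>))"

end

theory Submission
  imports Defs
begin

text \<open>
  A non-empty space without isolated points has two distinct points \<open>p\<close> and \<open>q\<close>. Take \<open>\<delta>\<close> so
  small that the closed \<open>\<delta>\<close>-balls around them are disjoint, and let \<open>N\<close> be the gap that the
  specification property gives for \<open>\<delta>\<close>. Since compositions of surjective maps are surjective, every
  prescribed point is attained at every prescribed time by some orbit; specification, applied to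
  orbit segments of length one, glues such orbits together. Hence for every word every \<open>p\<close>-\<open>q\<close>
  itinerary along the times \<open>0, N, 2 N, \<dots>\<close> is followed up to \<open>\<delta>\<close> by an actual orbit
  (\<open>itinerary_shadowing\<close>).

  The two complements of the balls form an open cover of the space. At each time a member of the
  refined cover of a word forbids one of the two balls, so it contains at most one of these
  shadowing points. Up to time \<open>n\<close> there are at least \<open>2\<close> to the power \<open>n / N\<close> itineraries, which
  bounds the size of a subcover from below for each individual word
  (\<open>min_subcover_word_cover_ge\<close>). The bound survives averaging over the words, and the entropy is
  at least \<open>ln 2 / N\<close>.
\<close>

section \<open>Orbits with prescribed itineraries\<close>

lemma not_isolated_two_points:
  fixes X :: "'a::topological_space set"
  assumes "X \<noteq> {}" and "\<not> (\<exists>x. x isolated_in X)"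
  obtains p q where "p \<in> X" "q \<in> X" "p \<noteq> q"
proof -
  from assms(1) obtain p where p: "p \<in> X" by blast
  have "X \<noteq> {p}"
    using assms(2) by (metis Int_UNIV_left insertI1 isolated_in_def open_UNIV)
  with p that show thesis by blast
qed

lemma word_map_cong:
  assumes "\<And>i. m \<le> i \<Longrightarrow> i < m + k \<Longrightarrow> v i = w i"
  shows "word_map \<phi> v m k = word_map \<phi> w m k"
  using assms
proof (induction k)
  case 0
  then show ?case by simp
next
  case (Suc k)
  have "word_map \<phi> v m k = word_map \<phi> w m k" by (rule Suc.IH) (simp add: Suc.prems)
  moreover have "v (m + k) = w (m + k)" by (rule Suc.prems) simp_all
  ultimately show ?case by simp
qed

lemma word_map_image:
  assumes "surjective_maps X I \<phi>" and "1 \<le> m"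
    and "\<And>i. m \<le> i \<Longrightarrow> i < m + k \<Longrightarrow> w i \<in> I i"
  shows "word_map \<phi> w m k ` X = X"
  using assms(3)
proof (induction k)
  case 0
  then show ?case by simp
next
  case (Suc k)
  have "word_map \<phi> w m (Suc k) ` X = \<phi> (m + k) (w (m + k)) ` (word_map \<phi> w m k ` X)"
    by (simp add: image_comp)
  also have "\<dots> = X"
    using Suc assms(1,2) by (simp add: surjective_maps_def)
  finally show ?case .
qed

text \<open>
  Specification speaks of infinite words, whereas the entropy counts finite ones.
\<close>

lemma extend_word:
  assumes "w \<in> words I m n" and "\<And>j. m \<le> j \<Longrightarrow> I j \<noteq> {}"
  obtains v where "v \<in> infinite_words I m" "\<And>i. m \<le> i \<Longrightarrow> i < m + n \<Longrightarrow> v i = w i"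
proof
  let ?v = "\<lambda>i. if m + n \<le> i then SOME a. a \<in> I i else w i"
  show "?v \<in> infinite_words I m"
    using assms by (auto simp: infinite_words_def words_def PiE_def Pi_def extensional_def some_in_eq)
qed simp

text \<open>
  Specification is used only with segments consisting of a single time. The starting points that it
  asks for exist because the maps are surjective; this turns shadowing of orbits into shadowing of
  arbitrary sequences of target points.
\<close>

lemma itinerary_shadowing:
  fixes X :: "'a::metric_space set"
  assumes "naifs X I \<phi>" and surj: "surjective_maps X I \<phi>"
    and "specification_property X I \<phi>" and "\<delta> > 0"
  obtains N where "N > 0"
    "\<And>w n c. \<lbrakk>w \<in> words I 1 n; N \<le> n; \<forall>m\<le>n div N. c m \<in> X\<rbrakk> \<Longrightarrow>
      \<exists>y\<in>X. \<forall>m\<le>n div N. dist (word_map \<phi> w 1 (m * N) y) (c m) \<le> \<delta>"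
proof -
  obtain N0 where N0: "\<forall>w\<in>infinite_words I 1.
      \<forall>(s::nat) (x :: nat \<Rightarrow> 'a) (j :: nat \<Rightarrow> nat) (k :: nat \<Rightarrow> nat).
        s \<ge> 2 \<longrightarrow> (\<forall>m\<in>{1..s}. x m \<in> X) \<longrightarrow> j 1 = 0 \<longrightarrow> (\<forall>n\<in>{1..s}. j n \<le> k n) \<longrightarrow>
        (\<forall>n\<in>{1..<s}. k n < j (n + 1)) \<longrightarrow> (\<forall>n\<in>{1..<s}. k n + N0 \<le> j (n + 1)) \<longrightarrow>
        (\<exists>y\<in>X. \<forall>m\<in>{1..s}. \<forall>i\<in>{j m..k m}.
          dist (word_map \<phi> w 1 i y) (word_map \<phi> w 1 i (x m)) \<le> \<delta>)"
    using assms(3,4) unfolding specification_property_def by blast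
  (* Specification may hold with gap 0, but distinct segments must have distinct times. *)
  define N where "N = Suc N0"
  have "\<exists>y\<in>X. \<forall>m\<le>n div N. dist (word_map \<phi> w 1 (m * N) y) (c m) \<le> \<delta>"
    if w: "w \<in> words I 1 n" and "N \<le> n" and c: "\<forall>m\<le>n div N. c m \<in> X" for w n and c :: "nat \<Rightarrow> 'a"
  proof -
    let ?r = "n div N"
    obtain v where v: "v \<in> infinite_words I 1" "\<And>i. 1 \<le> i \<Longrightarrow> i < 1 + n \<Longrightarrow> v i = w i"
      using extend_word[OF w] assms(1) by (metis naifs_def)
    have letters: "v i \<in> I i" if "1 \<le> i" for i
      using v(1) that by (auto simp: infinite_words_def)
    have "\<exists>x\<in>X. word_map \<phi> v 1 (m * N) x = c m" if "m \<le> ?r" for m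
    proof -
      have "word_map \<phi> v 1 (m * N) ` X = X"
        using word_map_image[OF surj order_refl] letters by blast
      with c that show ?thesis by (metis imageE)
    qed
    then obtain x where x: "\<And>m. m \<le> ?r \<Longrightarrow> x m \<in> X \<and> word_map \<phi> v 1 (m * N) (x m) = c m"
      by metis
    have "?r > 0"
      using \<open>N \<le> n\<close> by (simp add: N_def div_greater_zero_iff)
    moreover have "x (m - 1) \<in> X" if "m \<in> {1..Suc ?r}" for m
      using x[of "m - 1"] that by auto
    moreover have "N > 0" by (simp add: N_def)
    moreover have "(m - 1) * N + N0 \<le> m * N" if "1 \<le> m" for m
      using that by (cases m) (simp_all add: N_def)
    ultimately have "\<exists>y\<in>X. \<forall>m\<in>{1..Suc ?r}. \<forall>i\<in>{(m - 1) * N..(m - 1) * N}.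
        dist (word_map \<phi> v 1 i y) (word_map \<phi> v 1 i (x (m - 1))) \<le> \<delta>"
      by (intro N0[THEN bspec, OF v(1), rule_format, of "Suc ?r" "\<lambda>m. x (m - 1)"
            "\<lambda>m. (m - 1) * N" "\<lambda>m. (m - 1) * N"]) simp_all
    then obtain y where "y \<in> X"
      and y: "\<And>m. m \<in> {1..Suc ?r} \<Longrightarrow>
        dist (word_map \<phi> v 1 ((m - 1) * N) y) (word_map \<phi> v 1 ((m - 1) * N) (x (m - 1))) \<le> \<delta>"
      by auto
    have "dist (word_map \<phi> w 1 (m * N) y) (c m) \<le> \<delta>" if m: "m \<le> ?r" for m
    proof -
      have "m * N \<le> n"
        using m by (meson div_times_less_eq_dividend le_trans mult_le_mono1)
      then have "word_map \<phi> v 1 (m * N) = word_map \<phi> w 1 (m * N)"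
        using v(2) by (intro word_map_cong) simp
      with y[of "Suc m"] x[OF m] m show ?thesis by simp
    qed
    with \<open>y \<in> X\<close> show ?thesis by blast
  qed
  then show thesis by (intro that[of N]) (auto simp: N_def)
qed

section \<open>Lower bounds for subcovers\<close>

lemma finite_join_families:
  assumes "finite J" and "\<And>j. j \<in> J \<Longrightarrow> finite (\<C> j)"
  shows "finite (join_families J \<C>)"
proof (rule finite_surj)
  show "finite (Pi\<^sub>E J \<C>)" using assms by (rule finite_PiE)
  show "join_families J \<C> \<subseteq> (\<lambda>F. \<Inter>j\<in>J. F j) ` Pi\<^sub>E J \<C>"
  proof
    fix A assume "A \<in> join_families J \<C>"
    then obtain F where "A = (\<Inter>j\<in>J. F j)" "\<forall>j\<in>J. F j \<in> \<C> j"
      by (auto simp: join_families_def)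
    then have "A = (\<Inter>j\<in>J. restrict F J j)" "restrict F J \<in> Pi\<^sub>E J \<C>" by auto
    then show "A \<in> (\<lambda>F. \<Inter>j\<in>J. F j) ` Pi\<^sub>E J \<C>" by blast
  qed
qed

lemma Union_word_cover:
  assumes "\<And>j. j \<le> n \<Longrightarrow> word_map \<phi> w m j ` X \<subseteq> \<Union>\<A>"
  shows "X \<subseteq> \<Union>(word_cover X \<phi> \<A> w m n)"
proof
  fix x assume x: "x \<in> X"
  then have "\<forall>j\<in>{0..n}. \<exists>A\<in>\<A>. word_map \<phi> w m j x \<in> A" using assms by fastforce
  then obtain F where F: "\<forall>j\<in>{0..n}. F j \<in> \<A> \<and> word_map \<phi> w m j x \<in> F j" by metis
  let ?A = "\<Inter>j\<in>{0..n}. word_map \<phi> w m j -` F j \<inter> X"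
  have "?A \<in> word_cover X \<phi> \<A> w m n"
    unfolding word_cover_def join_families_def preimage_family_def
    using F by (intro CollectI exI[of _ "\<lambda>j. word_map \<phi> w m j -` F j \<inter> X"] conjI) simp_all
  moreover have "x \<in> ?A" using F x by simp
  ultimately show "x \<in> \<Union>(word_cover X \<phi> \<A> w m n)" by blast
qed

text \<open>
  Points no two of which lie in a common member need different members to cover them. The hypotheses
  on \<open>\<C>\<close> guarantee that some finite subcover exists, so that the minimum is attained.
\<close>

lemma card_separated_le_min_subcover:
  assumes "finite \<C>" and "X \<subseteq> \<Union>\<C>" and "y ` K \<subseteq> X"
    and sep: "\<And>A a b. \<lbrakk>A \<in> \<C>; a \<in> K; b \<in> K; y a \<in> A; y b \<in> A\<rbrakk> \<Longrightarrow> a = b"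
  shows "card K \<le> min_subcover X \<C>"
proof -
  have "\<exists>k. \<exists>\<B>\<subseteq>\<C>. finite \<B> \<and> X \<subseteq> \<Union>\<B> \<and> card \<B> = k" using assms(1,2) by blast
  then have "\<exists>\<B>\<subseteq>\<C>. finite \<B> \<and> X \<subseteq> \<Union>\<B> \<and> card \<B> = min_subcover X \<C>"
    unfolding min_subcover_def by (rule LeastI_ex)
  then obtain \<B> where \<B>: "\<B> \<subseteq> \<C>" "finite \<B>" "X \<subseteq> \<Union>\<B>" "card \<B> = min_subcover X \<C>" by blast
  have "\<forall>a\<in>K. \<exists>B\<in>\<B>. y a \<in> B" using \<B>(3) assms(3) by blast
  then obtain g where g: "\<forall>a\<in>K. g a \<in> \<B> \<and> y a \<in> g a" by metis
  have "inj_on g K"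
  proof (rule inj_onI)
    fix a b assume "a \<in> K" "b \<in> K" "g a = g b"
    with g \<B>(1) show "a = b" by (intro sep[of "g a"]) auto
  qed
  with g \<B>(2) have "card K \<le> card \<B>" by (intro card_inj_on_le[of g]) auto
  with \<B>(4) show ?thesis by simp
qed

text \<open>
  Each member of the cover \<open>{X - P, X - Q}\<close> misses \<open>P\<close> or \<open>Q\<close>, so a member of its refinement cannot
  contain two points whose itineraries through \<open>P\<close> and \<open>Q\<close> differ at one of the times \<open>m * N\<close>. There
  are \<open>n div N + 1\<close> such times up to \<open>n\<close>.
\<close>

lemma min_subcover_word_cover_ge:
  assumes "P \<inter> Q = {}" and "N > 0"
    and maps: "\<And>j. j \<le> n \<Longrightarrow> word_map \<phi> w l j ` X \<subseteq> X"
    and itin: "\<And>S. \<exists>y\<in>X. \<forall>m\<le>n div N. word_map \<phi> w l (m * N) y \<in> (if m \<in> S then P else Q)"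
  shows "2 ^ Suc (n div N) \<le> min_subcover X (word_cover X \<phi> {X - P, X - Q} w l n)"
proof -
  let ?C = "word_cover X \<phi> {X - P, X - Q} w l n"
  obtain y where y: "\<And>S. y S \<in> X"
    "\<And>S m. m \<le> n div N \<Longrightarrow> word_map \<phi> w l (m * N) (y S) \<in> (if m \<in> S then P else Q)"
    using itin by metis
  have "card (Pow {..n div N}) \<le> min_subcover X ?C"
  proof (rule card_separated_le_min_subcover)
    show "finite ?C"
      unfolding word_cover_def by (rule finite_join_families) (auto simp: preimage_family_def)
    have "\<Union>{X - P, X - Q} = X" using assms(1) by blast
    then show "X \<subseteq> \<Union>?C" using maps by (intro Union_word_cover) metis
    show "y ` Pow {..n div N} \<subseteq> X" using y(1) by blast
  next
    fix A S T
    assume A: "A \<in> ?C" and S: "S \<in> Pow {..n div N}" and T: "T \<in> Pow {..n div N}"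
      and yA: "y S \<in> A" "y T \<in> A"
    show "S = T"
    proof (rule ccontr)
      assume "S \<noteq> T"
      with S T obtain m where m: "m \<le> n div N" "m \<in> S \<longleftrightarrow> m \<notin> T" by blast
      have "m * N \<le> n"
        using m(1) by (meson div_times_less_eq_dividend le_trans mult_le_mono1)
      obtain G where "A = (\<Inter>j\<in>{0..n}. G j)"
        and "\<forall>j\<in>{0..n}. G j \<in> preimage_family X (word_map \<phi> w l j) {X - P, X - Q}"
        using A unfolding word_cover_def join_families_def by blast
      with \<open>m * N \<le> n\<close> have "A \<subseteq> G (m * N)"
        and "G (m * N) \<in> preimage_family X (word_map \<phi> w l (m * N)) {X - P, X - Q}"
        by (simp_all add: INT_lower)
      then obtain B where B: "B \<in> {X - P, X - Q}"
        "word_map \<phi> w l (m * N) (y S) \<in> B" "word_map \<phi> w l (m * N) (y T) \<in> B"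
        using yA unfolding preimage_family_def by blast
      with y(2)[OF m(1), of S] y(2)[OF m(1), of T] m(2) show False
        by (auto split: if_splits)
    qed
  qed
  then show ?thesis by (simp add: card_Pow)
qed

section \<open>From subcovers to entropy\<close>

text \<open>
  An exponential lower bound with the same rate for all words passes to their average, whatever the
  numbers of words are.
\<close>

lemma h_top_ge:
  assumes "naifs X I \<phi>" and "open_cover X \<A>" and "N > 0"
    and bound: "\<And>n w. \<lbrakk>N \<le> n; w \<in> words I 1 n\<rbrakk> \<Longrightarrow>
      2 ^ Suc (n div N) \<le> min_subcover X (word_cover X \<phi> \<A> w 1 n)"
  shows "ereal (ln 2 / real N) \<le> h_top X I \<phi>"
proof -
  let ?avg = "\<lambda>n. 1 / real (card (words I 1 n)) *
    (\<Sum>w\<in>words I 1 n. real (min_subcover X (word_cover X \<phi> \<A> w 1 n)))"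
  have "ln 2 / real N \<le> 1 / real n * ln (?avg n)" if n: "N \<le> n" for n
  proof -
    let ?W = "words I 1 n"
    have "finite ?W" "?W \<noteq> {}"
      using assms(1) by (auto simp: words_def naifs_def PiE_eq_empty_iff intro!: finite_PiE)
    then have card: "real (card ?W) > 0" by (simp add: card_gt_0_iff)
    have "real (card ?W) * 2 ^ Suc (n div N) = (\<Sum>w\<in>?W. 2 ^ Suc (n div N))" by simp
    also have "\<dots> \<le> (\<Sum>w\<in>?W. real (min_subcover X (word_cover X \<phi> \<A> w 1 n)))"
    proof (rule sum_mono)
      fix w assume "w \<in> ?W"
      from bound[OF n this]
      have "real (2 ^ Suc (n div N)) \<le> real (min_subcover X (word_cover X \<phi> \<A> w 1 n))"
        by (rule of_nat_mono)
      then show "2 ^ Suc (n div N) \<le> real (min_subcover X (word_cover X \<phi> \<A> w 1 n))" by simp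
    qed
    finally have "2 ^ Suc (n div N) \<le> ?avg n"
      using card by (simp add: field_simps)
    then have "ln (2 ^ Suc (n div N)) \<le> ln (?avg n)"
      by (subst ln_le_cancel_iff) (auto intro: less_le_trans[of _ "2 ^ Suc (n div N)"])
    then have "real (Suc (n div N)) * ln 2 \<le> ln (?avg n)"
      by (subst (asm) ln_realpow) simp_all
    moreover have "real n / real N \<le> real (Suc (n div N))"
    proof -
      have "n \<le> Suc (n div N) * N"
        using dividend_less_div_times[OF \<open>N > 0\<close>, of n] by simp
      then have "real n \<le> real (Suc (n div N)) * real N"
        by (metis of_nat_le_iff of_nat_mult)
      then show ?thesis using \<open>N > 0\<close> by (simp add: field_simps)
    qed
    then have "real n / real N * ln 2 \<le> real (Suc (n div N)) * ln 2"
      by (intro mult_right_mono) simp_all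
    ultimately have "real n / real N * ln 2 \<le> ln (?avg n)" by linarith
    with \<open>N > 0\<close> n show ?thesis by (simp add: field_simps)
  qed
  then have "ereal (ln 2 / real N) \<le> limsup (\<lambda>n. ereal (1 / real n * ln (?avg n)))"
    by (intro le_Limsup eventually_sequentiallyI[of N]) simp_all
  also have "\<dots> \<le> h_top X I \<phi>"
    unfolding h_top_def using assms(2) by (intro SUP_upper) simp
  finally show ?thesis .
qed

theorem theorem4p5:
  fixes X :: "'a::metric_space set"
    and I :: "nat \<Rightarrow> 'i set"
    and \<phi> :: "nat \<Rightarrow> 'i \<Rightarrow> 'a \<Rightarrow> 'a"
  assumes "compact X" and "X \<noteq> {}"
    and "\<not> (\<exists>x. x isolated_in X)"
    and "naifs X I \<phi>"
    and "surjective_maps X I \<phi>"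
    and "specification_property X I \<phi>"
  shows "h_top X I \<phi> > 0"
proof -
  obtain p q where pq: "p \<in> X" "q \<in> X" "p \<noteq> q"
    using not_isolated_two_points assms(2,3) by blast
  define \<delta> where "\<delta> = dist p q / 3"
  have "\<delta> > 0" using pq by (simp add: \<delta>_def)
  let ?P = "cball p \<delta>" and ?Q = "cball q \<delta>"
  have disj: "?P \<inter> ?Q = {}"
  proof -
    have False if "dist p z \<le> \<delta>" "dist q z \<le> \<delta>" for z
      using that \<open>\<delta> > 0\<close> dist_triangle2[of p q z] \<delta>_def by linarith
    then show ?thesis by auto
  qed
  have cover: "open_cover X {X - ?P, X - ?Q}"
    using disj by (auto simp: open_cover_def Diff_eq intro!: openin_open_Int)
  obtain N where N: "N > 0"
    "\<And>w n c. \<lbrakk>w \<in> words I 1 n; N \<le> n; \<forall>m\<le>n div N. c m \<in> X\<rbrakk> \<Longrightarrow>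
      \<exists>y\<in>X. \<forall>m\<le>n div N. dist (word_map \<phi> w 1 (m * N) y) (c m) \<le> \<delta>"
    using itinerary_shadowing[OF assms(4-6) \<open>\<delta> > 0\<close>] by metis
  have "ereal (ln 2 / real N) \<le> h_top X I \<phi>"
  proof (rule h_top_ge[OF assms(4) cover N(1)])
    fix n w assume n: "N \<le> n" and w: "w \<in> words I 1 n"
    show "2 ^ Suc (n div N) \<le> min_subcover X (word_cover X \<phi> {X - ?P, X - ?Q} w 1 n)"
    proof (rule min_subcover_word_cover_ge[OF disj N(1)])
      fix j assume "j \<le> n"
      then have "word_map \<phi> w 1 j ` X = X"
        using w by (intro word_map_image[OF assms(5)]) (auto simp: words_def)
      then show "word_map \<phi> w 1 j ` X \<subseteq> X" by simp
    next
      fix S :: "nat set"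
      have "\<forall>m\<le>n div N. (if m \<in> S then p else q) \<in> X" using pq by simp
      from N(2)[OF w n this]
      obtain y where "y \<in> X"
        "\<forall>m\<le>n div N. dist (word_map \<phi> w 1 (m * N) y) (if m \<in> S then p else q) \<le> \<delta>" by blast
      then show "\<exists>y\<in>X. \<forall>m\<le>n div N. word_map \<phi> w 1 (m * N) y \<in> (if m \<in> S then ?P else ?Q)"
        by (intro bexI[of _ y]) (auto simp: dist_commute)
    qed
  qed
  moreover have "0 < ereal (ln 2 / real N)" using N(1) by simp
  ultimately show ?thesis by (rule less_le_trans[rotated])
qed

end
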